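(* For complex $\alpha,\beta,m,x,z$, $$\sum_{n=0}^{\infty}\frac{\Gamma(m+n+\alpha+1)\,\Bigl(\frac{x(xz+1)^{-\beta}}{x+1}\Bigr)^n\;{}_2F_1\bigl(-n,-((m+n)\beta);\,m+\alpha+1;\,z\bigr)}{\Gamma(n+1)\,\Gamma(m+\alpha+1)}=-\frac{x^m(x+1)^{\alpha+1}(xz+1)\Bigl(\frac{x(xz+1)^{-\beta}}{x+1}\Bigr)^{-m}}{\beta x^2z+\beta xz-xz-1}.$$
   Context: $\Gamma$ is the Euler gamma function and ${}_2F_1(a,b;c;z)=\sum_{k\ge0}\frac{(a)_k(b)_k}{(c)_k\,k!}z^k$ is the Gauss hypergeometric function, with $(a)_k=a(a+1)\cdots(a+k-1)$.
   Formalization: Proved for m+α+1 not a non-positive integer and x≠0 in the component of 0 where the series converges absolutely inside its disc and x+1, xz+1 avoid the cuts; x^m and the (-m)-th power use consistent branches (principal if m is an integer or the logs combine). False for general x. *)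

theory Defs
  imports "HOL-Analysis.Analysis"
begin

definition hyp2F1 :: "complex \<Rightarrow> complex \<Rightarrow> complex \<Rightarrow> complex \<Rightarrow> complex" where
  "hyp2F1 a b c z =
     (\<Sum>k. pochhammer a k * pochhammer b k / (pochhammer c k * fact k) * z ^ k)"

text \<open>The quantity whose \<open>n\<close>-th powers occur in the series; principal power.\<close>

definition gen_arg :: "complex \<Rightarrow> complex \<Rightarrow> complex \<Rightarrow> complex" where
  "gen_arg \<beta> z x = x * (x * z + 1) powr (- \<beta>) / (x + 1)"

definition gen_coeff :: "complex \<Rightarrow> complex \<Rightarrow> complex \<Rightarrow> complex \<Rightarrow> nat \<Rightarrow> complex" where
  "gen_coeff \<alpha> \<beta> m z n =
     Gamma (m + of_nat n + \<alpha> + 1)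
       * hyp2F1 (- of_nat n) (- ((m + of_nat n) * \<beta>)) (m + \<alpha> + 1) z
     / (Gamma (of_nat n + 1) * Gamma (m + \<alpha> + 1))"

text \<open>
  The series is a power series in \<open>gen_arg \<beta> z x\<close>. Since \<open>gen_arg \<beta> z\<close> is not injective, the
  series may converge at points \<open>x\<close> lying on another sheet, where the closed form is wrong: for
  \<open>\<beta> = 1\<close> the points \<open>x\<close> and \<open>1 / (x * z)\<close> give the same series, but different closed forms.
  The domain is therefore the connected component of \<open>0\<close> in the set of points inside the disc of
  convergence at which the principal powers of \<open>x + 1\<close> and \<open>x * z + 1\<close> are holomorphic.
\<close>

definition gen_domain :: "complex \<Rightarrow> complex \<Rightarrow> complex \<Rightarrow> complex \<Rightarrow> complex set" where
  "gen_domain \<alpha> \<beta> m z =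
     connected_component_set
       {x. x + 1 \<notin> \<real>\<^sub>\<le>\<^sub>0 \<and> x * z + 1 \<notin> \<real>\<^sub>\<le>\<^sub>0 \<and>
           ereal (norm (gen_arg \<beta> z x)) < conv_radius (gen_coeff \<alpha> \<beta> m z)} 0"

end

theory Submission
  imports Defs "HOL-Complex_Analysis.Complex_Analysis"
begin

text \<open>
  The \<open>n\<close>-th coefficient of the series is the coefficient of
  \<open>x\<^sup>n\<close> in \<open>H(x) \<phi>(x)\<^sup>n\<close>, where \<open>\<phi>(x) = (1 + x) (1 + x z)\<^sup>\<beta>\<close> and \<open>H = \<phi>\<^sup>m (1 + x)\<^sup>\<alpha>\<close>. Since the argument of the series is \<open>t = x / \<phi>(x)\<close>,
  Lagrange inversion gives \<open>\<Sum>\<^sub>n a\<^sub>n t\<^sup>n = H / (1 - x \<phi>' / \<phi>)\<close> for \<open>x\<close> near \<open>0\<close>. Cleared of its denominator,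
  this is an identity of holomorphic functions on the domain, hence holds there by
  analytic continuation; as the numerator has no zeros, neither has the denominator.
\<close>

section \<open>Formal Lagrange inversion\<close>

text \<open>As \<open>u\<close> has no constant term, \<open>u ^ i\<close> contributes only from
  degree \<open>i\<close> on. Hence one bound \<open>i \<le> n\<close> serves all coefficients
  \<open>j \<le> n\<close> at once, and the two sums can be swapped.\<close>

lemma fps_nth_compose_mult:
  fixes g u p :: "'a::comm_ring_1 fps"
  assumes "fps_nth u 0 = 0"
  shows "fps_nth ((g oo u) * p) n = (\<Sum>i\<le>n. fps_nth g i * fps_nth (u ^ i * p) n)"
proof -
  have "fps_nth (g oo u) j = (\<Sum>i\<le>n. fps_nth g i * fps_nth (u ^ i) j)" if "j \<le> n" for j
    unfolding fps_compose_nth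
    by (rule sum.mono_neutral_left)
       (use that startsby_zero_power_prefix[OF assms] in auto)
  then have "fps_nth ((g oo u) * p) n =
      (\<Sum>j\<le>n. \<Sum>i\<le>n. fps_nth g i * fps_nth (u ^ i) j * fps_nth p (n - j))"
    by (simp add: fps_mult_nth atLeast0AtMost sum_distrib_right)
  also have "\<dots> = (\<Sum>i\<le>n. \<Sum>j\<le>n. fps_nth g i * fps_nth (u ^ i) j * fps_nth p (n - j))"
    by (rule sum.swap)
  also have "\<dots> = (\<Sum>i\<le>n. fps_nth g i * fps_nth (u ^ i * p) n)"
    by (simp add: fps_mult_nth atLeast0AtMost sum_distrib_left mult.assoc)
  finally show ?thesis .
qed

text \<open>
  The residue of \<open>g(u) u' / u\<^sup>n\<^sup>+\<^sup>1\<close>, with \<open>1 / u\<close> written as \<open>\<phi> / X\<close> to avoid Laurent series: for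
  \<open>i \<noteq> n\<close> the term \<open>u\<^sup>i u' / u\<^sup>n\<^sup>+\<^sup>1\<close> is a derivative, and so contributes nothing.
\<close>

lemma fps_lagrange_nth:
  fixes g u \<phi> :: "'a::field_char_0 fps"
  assumes u0: "fps_nth u 0 = 0" and u: "u * \<phi> = fps_X"
  shows "fps_nth ((g oo u) * (fps_deriv u * \<phi> ^ Suc n)) n = fps_nth g n"
proof -
  have du: "fps_deriv u * \<phi> = 1 - u * fps_deriv \<phi>"
    using arg_cong[OF u, of fps_deriv] by (simp add: algebra_simps eq_diff_eq)
  have residue: "fps_nth (fps_deriv u * \<phi> ^ Suc j) j = (if j = 0 then 1 else 0)" for j
  proof (cases j)
    case 0
    then show ?thesis using u0 by (simp add: du)
  next
    case (Suc k)
    have "fps_deriv u * \<phi> ^ Suc j = (fps_deriv u * \<phi>) * \<phi> ^ Suc k"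
      by (simp add: Suc algebra_simps)
    also have "\<dots> = \<phi> ^ Suc k - (u * \<phi>) * (fps_deriv \<phi> * \<phi> ^ k)"
      unfolding du by (simp add: algebra_simps)
    finally have "fps_nth (fps_deriv u * \<phi> ^ Suc j) j
        = fps_nth (\<phi> ^ Suc k) (Suc k) - fps_nth (fps_deriv \<phi> * \<phi> ^ k) k"
      unfolding u by (simp add: Suc)
    \<comment> \<open>Both sides are the \<open>k\<close>-th coefficient of the derivative of
      \<open>\<phi> ^ Suc k\<close>; characteristic zero then allows cancelling
      \<open>Suc k\<close>.\<close>
    moreover have "of_nat (Suc k) * fps_nth (\<phi> ^ Suc k) (Suc k)
        = of_nat (Suc k) * fps_nth (fps_deriv \<phi> * \<phi> ^ k) k"
    proof -
      have "of_nat (Suc k) * fps_nth (\<phi> ^ Suc k) (Suc k) = fps_nth (fps_deriv (\<phi> ^ Suc k)) k"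
        by (simp only: fps_deriv_nth Suc_eq_plus1)
      also have "fps_deriv (\<phi> ^ Suc k) = fps_const (of_nat (Suc k)) * (fps_deriv \<phi> * \<phi> ^ k)"
        by (simp only: fps_deriv_power diff_Suc_1 mult.assoc)
      finally show ?thesis by (simp only: fps_mult_left_const_nth)
    qed
    ultimately show ?thesis
      using Suc by (simp del: power_Suc of_nat_Suc)
  qed
  have "fps_nth (u ^ i * (fps_deriv u * \<phi> ^ Suc n)) n = (if i = n then 1 else 0)" if "i \<le> n" for i
  proof -
    \<comment> \<open>Pairing each factor \<open>u\<close> with one \<open>\<phi>\<close> produces
      \<open>fps_X ^ i\<close>, which lowers the index from \<open>n\<close> to
      \<open>n - i\<close>, where \<open>residue\<close> applies.\<close>
    have "u ^ i * (fps_deriv u * \<phi> ^ Suc n) = u ^ i * (fps_deriv u * \<phi> ^ (i + Suc (n - i)))"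
      using that by simp
    also have "\<dots> = (u * \<phi>) ^ i * (fps_deriv u * \<phi> ^ Suc (n - i))"
      by (simp only: power_add power_mult_distrib mult_ac)
    finally have shift: "u ^ i * (fps_deriv u * \<phi> ^ Suc n) = fps_X ^ i * (fps_deriv u * \<phi> ^ Suc (n - i))"
      unfolding u .
    show ?thesis
      unfolding shift fps_X_power_mult_nth residue using that by auto
  qed
  then have "fps_nth ((g oo u) * (fps_deriv u * \<phi> ^ Suc n)) n
      = (\<Sum>i\<le>n. if i = n then fps_nth g i else 0)"
    unfolding fps_nth_compose_mult[OF u0] by (intro sum.cong) auto
  then show ?thesis by simp
qed

section \<open>Lagrange inversion for holomorphic functions\<close>

text \<open>Near 0 the map \<open>x / \<phi> x\<close> has a holomorphic inverse \<open>g\<close>,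
  so changing variables in \<open>H / \<phi>\<close> gives a function \<open>G\<close> holomorphic
  at 0. The formal lemma identifies its Taylor series with \<open>A\<close>; the positive radius is
  then a consequence of holomorphy and needs no estimates.\<close>

lemma analytic_lagrange:
  fixes H \<phi> :: "complex \<Rightarrow> complex"
  assumes H: "H has_fps_expansion Hf" and \<phi>: "\<phi> has_fps_expansion \<phi>f" and \<phi>0: "fps_nth \<phi>f 0 \<noteq> 0"
  defines "A \<equiv> Abs_fps (\<lambda>n. fps_nth (Hf * \<phi>f ^ n) n)"
  shows "fps_conv_radius A > 0"
    and "eventually (\<lambda>x. eval_fps A (x * inverse (\<phi> x)) * deriv (\<lambda>x. x * inverse (\<phi> x)) x
                           = H x * inverse (\<phi> x)) (nhds 0)"
proof -
  define \<tau> where "\<tau> = (\<lambda>x. x * inverse (\<phi> x))"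
  define u where "u = fps_X * inverse \<phi>f"
  define K where "K = (\<lambda>x. H x * inverse (\<phi> x))"
  have \<tau>: "\<tau> has_fps_expansion u"
    unfolding \<tau>_def u_def by (intro fps_expansion_intros \<phi> \<phi>0)
  have K: "K has_fps_expansion Hf * inverse \<phi>f"
    unfolding K_def by (intro fps_expansion_intros \<phi> \<phi>0 H)
  have d\<tau>: "deriv \<tau> has_fps_expansion fps_deriv u"
    by (intro fps_expansion_intros \<tau>)
  have u0: "fps_nth u 0 = 0" and u: "u * \<phi>f = fps_X"
    using \<phi>0 by (simp_all add: u_def mult.assoc inverse_mult_eq_1)
  \<comment> \<open>The linear coefficient of \<open>u\<close> is \<open>1 / \<phi> 0\<close>, so
    \<open>\<tau>\<close> is locally injective.\<close>
  have "deriv \<tau> 0 = fps_nth u 1"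
    using fps_nth_fps_expansion[OF \<tau>, of 1] by simp
  then have \<tau>'0: "deriv \<tau> 0 \<noteq> 0"
    using \<phi>0 by (simp add: u_def)
  obtain S1 where S1: "open S1" "0 \<in> S1" "\<tau> holomorphic_on S1"
    using has_fps_expansion_imp_holomorphic[OF \<tau>] by metis
  obtain S2 where S2: "open S2" "0 \<in> S2" "K holomorphic_on S2"
    using has_fps_expansion_imp_holomorphic[OF K] by metis
  have "\<tau> holomorphic_on S1 \<inter> S2" "0 \<in> S1 \<inter> S2" "open (S1 \<inter> S2)"
    using S1 S2 by (auto intro: holomorphic_on_subset)
  then obtain r where r: "r > 0" "ball 0 r \<subseteq> S1 \<inter> S2" "inj_on \<tau> (ball 0 r)"
    using has_complex_derivative_locally_injective \<tau>'0 by metis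
  have hol\<tau>: "\<tau> holomorphic_on ball 0 r" and holK: "K holomorphic_on ball 0 r"
    using S1 S2 r by (auto intro: holomorphic_on_subset)
  obtain g where g: "g holomorphic_on (\<tau> ` ball 0 r)"
      "\<And>x. x \<in> ball 0 r \<Longrightarrow> deriv \<tau> x * deriv g (\<tau> x) = 1"
      "\<And>x. x \<in> ball 0 r \<Longrightarrow> g (\<tau> x) = x"
    using holomorphic_has_inverse[OF hol\<tau> open_ball r(3)] by metis
  have op: "open (\<tau> ` ball 0 r)"
    using open_mapping_thm3[OF hol\<tau> open_ball r(3)] .
  \<comment> \<open>The factor \<open>deriv g t\<close> is chosen to cancel against
    \<open>deriv \<tau> x\<close>, so that
    \<open>G (\<tau> x) * deriv \<tau> x = K x\<close>.\<close>
  define G where "G = (\<lambda>t. K (g t) * deriv g t)"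
  have "(K \<circ> g) holomorphic_on \<tau> ` ball 0 r"
    by (rule holomorphic_on_compose_gen[OF g(1) holK]) (auto simp: g(3))
  then have "G holomorphic_on \<tau> ` ball 0 r"
    unfolding G_def o_def by (intro holomorphic_on_mult holomorphic_deriv[OF g(1) op])
  moreover have "0 \<in> \<tau> ` ball 0 r"
    using r(1) by (auto simp: \<tau>_def image_iff intro!: bexI[of _ 0])
  ultimately obtain Gf where Gf: "G has_fps_expansion Gf"
    using has_fps_expansion_fps_expansion[OF op] by blast
  have "eventually (\<lambda>x. x \<in> ball 0 r) (nhds (0::complex))"
    using r(1) by (intro eventually_nhds_in_open) auto
  then have ev: "eventually (\<lambda>x. (G \<circ> \<tau>) x * deriv \<tau> x = K x) (nhds 0)"
    by eventually_elim (use g in \<open>simp add: G_def mult_ac\<close>)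
  have "(\<lambda>x. (G \<circ> \<tau>) x * deriv \<tau> x) has_fps_expansion (Gf oo u) * fps_deriv u"
    by (intro has_fps_expansion_mult has_fps_expansion_compose Gf \<tau> d\<tau> u0)
  then have "K has_fps_expansion (Gf oo u) * fps_deriv u"
    using has_fps_expansion_cong[OF ev refl] by blast
  then have eq: "(Gf oo u) * fps_deriv u = Hf * inverse \<phi>f"
    using K fps_expansion_unique_complex by blast
  have "fps_nth Gf n = fps_nth (Hf * \<phi>f ^ n) n" for n
  proof -
    have "(Gf oo u) * (fps_deriv u * \<phi>f ^ Suc n) = Hf * (inverse \<phi>f * \<phi>f) * \<phi>f ^ n"
      using eq by (simp add: mult.assoc[symmetric])
    then show ?thesis
      using fps_lagrange_nth[OF u0 u, of Gf n] \<phi>0 by (simp add: inverse_mult_eq_1 del: power_Suc)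
  qed
  then have GA: "Gf = A"
    by (simp add: A_def fps_eq_iff)
  show "fps_conv_radius A > 0"
    using Gf GA by (simp add: has_fps_expansion_def)
  have "eventually (\<lambda>t. eval_fps A t = G t) (nhds 0)"
    using Gf GA by (simp add: has_fps_expansion_def)
  moreover have "filterlim \<tau> (nhds 0) (nhds 0)"
    using has_fps_expansion_imp_continuous[OF \<tau>, of UNIV]
    by (simp add: isCont_def tendsto_nhds_iff \<tau>_def)
  ultimately have "eventually (\<lambda>x. eval_fps A (\<tau> x) = G (\<tau> x)) (nhds 0)"
    by (rule eventually_compose_filterlim)
  with ev show "eventually (\<lambda>x. eval_fps A (x * inverse (\<phi> x)) * deriv (\<lambda>x. x * inverse (\<phi> x)) x
                           = H x * inverse (\<phi> x)) (nhds 0)"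
    by eventually_elim (simp add: \<tau>_def K_def)
qed

section \<open>Series coefficients as Taylor coefficients\<close>

lemma hyp2F1_of_neg_nat:
  "hyp2F1 (- of_nat n) b c z =
     (\<Sum>k\<le>n. pochhammer (- of_nat n) k * pochhammer b k / (pochhammer c k * fact k) * z ^ k)"
  unfolding hyp2F1_def by (rule suminf_finite) (auto simp: pochhammer_of_nat_eq_0_lemma)

lemma pochhammer_neg_of_nat:
  assumes "k \<le> n"
  shows "pochhammer (- of_nat n :: 'a::field_char_0) k = (-1) ^ k * fact n / fact (n - k)"
proof -
  have "pochhammer (- of_nat n :: 'a) k = (-1) ^ k * (fact k * (of_nat n gchoose k))"
    by (simp add: gbinomial_pochhammer flip: mult.assoc power_mult_distrib)
  also have "fact k * (of_nat n gchoose k) = (fact n / fact (n - k) :: 'a)"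
    using binomial_fact[OF assms, where 'a = 'a] by (simp add: binomial_gbinomial)
  finally show ?thesis by simp
qed

text \<open>With \<open>c = m + \<alpha> + 1\<close>, the Gamma quotient is
  \<open>pochhammer c n\<close>, and dividing by \<open>pochhammer c k\<close> leaves
  \<open>pochhammer (c + of_nat k) (n - k)\<close>. Each term thus becomes a product of two binomial
  coefficients, and the sum is a Cauchy product.\<close>

lemma gen_coeff_eq_nth:
  assumes "m + \<alpha> + 1 \<notin> \<int>\<^sub>\<le>\<^sub>0"
  shows "gen_coeff \<alpha> \<beta> m z n =
    fps_nth (fps_binomial (m + \<alpha> + of_nat n)
             * (fps_binomial (\<beta> * (m + of_nat n)) oo (fps_const z * fps_X))) n"
proof -
  define c where "c = m + \<alpha> + 1"
  have c: "c \<notin> \<int>\<^sub>\<le>\<^sub>0" using assms by (simp add: c_def)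
  define b where "b = \<beta> * (m + of_nat n)"
  have nz: "pochhammer c k \<noteq> 0" for k
    using c by (auto simp: pochhammer_eq_0_iff)
  have "gen_coeff \<alpha> \<beta> m z n = pochhammer c n / fact n * hyp2F1 (- of_nat n) (- b) c z"
    unfolding gen_coeff_def pochhammer_Gamma[OF c] Gamma_fact[symmetric]
    by (simp add: c_def b_def Gamma_fact add_ac mult_ac)
  also have "\<dots> = (\<Sum>k\<le>n. z ^ k * (b gchoose k) * ((m + \<alpha> + of_nat n) gchoose (n - k)))"
    unfolding hyp2F1_of_neg_nat sum_distrib_left
  proof (intro sum.cong refl)
    fix k assume "k \<in> {..n}"
    then have k: "k \<le> n" by simp
    have "(m + \<alpha> + of_nat n) gchoose (n - k) = pochhammer (c + of_nat k) (n - k) / fact (n - k)"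
      using k by (simp add: gbinomial_pochhammer' c_def of_nat_diff algebra_simps)
    then show "pochhammer c n / fact n *
         (pochhammer (- of_nat n) k * pochhammer (- b) k / (pochhammer c k * fact k) * z ^ k) =
         z ^ k * (b gchoose k) * ((m + \<alpha> + of_nat n) gchoose (n - k))"
      using nz[of k]
      by (simp add: pochhammer_neg_of_nat[OF k] pochhammer_product[OF k] gbinomial_pochhammer[of b]
          field_simps)
  qed
  also have "\<dots> = fps_nth (fps_binomial (m + \<alpha> + of_nat n)
             * (fps_binomial b oo (fps_const z * fps_X))) n"
    unfolding mult.commute[of "fps_binomial (m + \<alpha> + of_nat n)"]
    by (simp add: fps_mult_nth atLeast0AtMost)
  finally show ?thesis by (simp add: b_def)
qed


text \<open>Exponents of binomial series add, so the parts proportional to \<open>n\<close> split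
  off as an \<open>n\<close>-th power. This is the shape that \<open>analytic_lagrange\<close>
  requires.\<close>

lemma gen_coeff_eq_lagrange:
  assumes "m + \<alpha> + 1 \<notin> \<int>\<^sub>\<le>\<^sub>0"
  shows "gen_coeff \<alpha> \<beta> m z n =
    fps_nth (fps_binomial (m + \<alpha>) * (fps_binomial (\<beta> * m) oo (fps_const z * fps_X))
             * (fps_binomial 1 * (fps_binomial \<beta> oo (fps_const z * fps_X))) ^ n) n"
proof -
  have "fps_binomial (b * of_nat n) = fps_binomial b ^ n" for b :: complex
    by (induction n) (simp_all add: fps_binomial_add_mult distrib_left)
  then have binomial_power: "fps_binomial (a + b * of_nat n) = fps_binomial a * fps_binomial b ^ n"
    for a b :: complex
    by (simp add: fps_binomial_add_mult)
  have 0: "fps_nth (fps_const z * fps_X) 0 = 0" by simp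
  show ?thesis
    unfolding gen_coeff_eq_nth[OF assms] distrib_left binomial_power[of "\<beta> * m" \<beta>]
      binomial_power[of "m + \<alpha>" 1, simplified]
      fps_compose_mult_distrib[OF 0] fps_compose_power[OF 0, symmetric]
    by (simp add: power_mult_distrib mult_ac)
qed

section \<open>Closed form near the origin\<close>

context
  fixes \<alpha> \<beta> m z :: complex
begin

text \<open>Here \<open>x powr m\<close> has been cancelled against the power \<open>- m\<close> of
  the series argument, so no branch of \<open>Ln x\<close> is involved and the numerator is
  holomorphic at 0.\<close>

definition "gen_num x = (x + 1) powr (m + \<alpha> + 1) * (x * z + 1) powr (\<beta> * m + 1)"

definition "gen_denom x = \<beta> * x\<^sup>2 * z + \<beta> * x * z - x * z - 1"

definition "gen_slit = {x. x + 1 \<notin> \<real>\<^sub>\<le>\<^sub>0 \<and> x * z + 1 \<notin> \<real>\<^sub>\<le>\<^sub>0}"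

lemma open_gen_slit: "open gen_slit"
proof -
  have "gen_slit = ((\<lambda>x. x + 1) -` (- \<real>\<^sub>\<le>\<^sub>0)) \<inter> ((\<lambda>x. x * z + 1) -` (- \<real>\<^sub>\<le>\<^sub>0))"
    by (auto simp: gen_slit_def)
  also have "open \<dots>"
    by (intro open_Int open_vimage continuous_intros) (auto simp: closed_nonpos_Reals_complex)
  finally show ?thesis .
qed

lemma zero_in_gen_slit: "0 \<in> gen_slit"
  by (simp add: gen_slit_def)

lemma gen_slit_nonzero: "x \<in> gen_slit \<Longrightarrow> x + 1 \<noteq> 0 \<and> x * z + 1 \<noteq> 0"
  by (auto simp: gen_slit_def)

text \<open>The exponent 1 is kept as a \<open>powr\<close> so that the factor matches the expansion
  \<open>fps_binomial 1\<close>.\<close>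

lemma gen_arg_eq: "gen_arg \<beta> z x = x * inverse ((1 + x) powr 1 * (1 + z * x) powr \<beta>)"
  by (simp add: gen_arg_def powr_minus field_simps add_ac)

text \<open>This is the origin of the denominator of the closed form: its zeros in
  \<open>gen_slit\<close> are the critical points of \<open>gen_arg \<beta> z\<close>.\<close>

lemma gen_arg_has_field_derivative:
  assumes "x \<in> gen_slit"
  shows "(gen_arg \<beta> z has_field_derivative
           - gen_denom x / ((x + 1)\<^sup>2 * (x * z + 1)) * (x * z + 1) powr (- \<beta>)) (at x)"
proof -
  have slit: "x + 1 \<noteq> 0" "x * z + 1 \<noteq> 0" "x * z + 1 \<notin> \<real>\<^sub>\<le>\<^sub>0"
    using assms gen_slit_nonzero by (auto simp: gen_slit_def)
  define P where "P = (x * z + 1) powr (- \<beta>)"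
  have P: "(x * z + 1) powr (- \<beta> - 1) = P / (x * z + 1)"
    using slit by (simp add: powr_diff P_def)
  have "(gen_arg \<beta> z has_field_derivative
     ((((x * z + 1) powr (- \<beta>) + x * (- \<beta> * (x * z + 1) powr (- \<beta> - 1) * z)) * (x + 1)
       - x * (x * z + 1) powr (- \<beta>)) / ((x + 1) * (x + 1)))) (at x)"
    unfolding gen_arg_def[abs_def]
    by (rule derivative_eq_intros refl slit | simp add: slit)+
  from this[unfolded P, folded P_def] show ?thesis
    unfolding P_def[symmetric]
  proof (rule DERIV_cong)
    show "((P + x * (- \<beta> * (P / (x * z + 1)) * z)) * (x + 1) - x * P) / ((x + 1) * (x + 1))
        = - gen_denom x / ((x + 1)\<^sup>2 * (x * z + 1)) * P"
      using slit(1,2)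
      by (simp add: gen_denom_def divide_simps) (simp add: algebra_simps power2_eq_square)
  qed
qed

lemma gen_arg_holomorphic: "gen_arg \<beta> z holomorphic_on gen_slit"
  using gen_arg_has_field_derivative open_gen_slit
  by (auto simp: holomorphic_on_open)

lemma gen_num_holomorphic: "gen_num holomorphic_on gen_slit"
  unfolding gen_num_def[abs_def] by (intro holomorphic_intros) (auto simp: gen_slit_def)

lemma gen_denom_holomorphic: "gen_denom holomorphic_on S"
  unfolding gen_denom_def[abs_def] by (intro holomorphic_intros)

text \<open>An instance of \<open>analytic_lagrange\<close> with the derivative of
  \<open>gen_arg\<close> inserted. Keeping \<open>gen_denom\<close> as a factor makes both sides
  holomorphic before its zeros are excluded.\<close>

lemma gen_series_near_0:
  assumes "m + \<alpha> + 1 \<notin> \<int>\<^sub>\<le>\<^sub>0"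
  defines "A \<equiv> Abs_fps (gen_coeff \<alpha> \<beta> m z)"
  shows "fps_conv_radius A > 0"
    and "eventually (\<lambda>x. eval_fps A (gen_arg \<beta> z x) * gen_denom x = - gen_num x) (nhds 0)"
proof -
  define H where "H = (\<lambda>x. (1 + x) powr (m + \<alpha>) * (1 + z * x) powr (\<beta> * m))"
  define \<phi> where "\<phi> = (\<lambda>x. (1 + x) powr 1 * (1 + z * x) powr \<beta>)"
  have lin: "(\<lambda>x. z * x) has_fps_expansion fps_const z * fps_X"
    by (intro fps_expansion_intros)
  have powr: "(\<lambda>x. (1 + z * x) powr b) has_fps_expansion (fps_binomial b oo (fps_const z * fps_X))" for b
    using has_fps_expansion_compose[OF has_fps_expansion_binomial_complex[of b] lin] by (simp add: o_def)
  have H: "H has_fps_expansion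
      fps_binomial (m + \<alpha>) * (fps_binomial (\<beta> * m) oo (fps_const z * fps_X))"
    unfolding H_def by (intro fps_expansion_intros powr)
  have \<phi>: "\<phi> has_fps_expansion fps_binomial 1 * (fps_binomial \<beta> oo (fps_const z * fps_X))"
    unfolding \<phi>_def by (intro fps_expansion_intros powr)
  have \<phi>0: "fps_nth (fps_binomial 1 * (fps_binomial \<beta> oo (fps_const z * fps_X))) 0 \<noteq> 0"
    by simp
  have A: "A = Abs_fps (\<lambda>n. fps_nth
      (fps_binomial (m + \<alpha>) * (fps_binomial (\<beta> * m) oo (fps_const z * fps_X))
       * (fps_binomial 1 * (fps_binomial \<beta> oo (fps_const z * fps_X))) ^ n) n)"
    unfolding A_def by (intro arg_cong[where f = Abs_fps] ext gen_coeff_eq_lagrange assms)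
  note lagrange = analytic_lagrange[OF H \<phi> \<phi>0, folded A]
  show "fps_conv_radius A > 0"
    by (fact lagrange(1))
  have \<tau>: "(\<lambda>x. x * inverse (\<phi> x)) = gen_arg \<beta> z"
    by (simp add: fun_eq_iff gen_arg_eq \<phi>_def)
  have "eventually (\<lambda>x. x \<in> gen_slit) (nhds 0)"
    using open_gen_slit zero_in_gen_slit by (intro eventually_nhds_in_open)
  with lagrange(2)[unfolded \<tau> fun_cong[OF \<tau>]]
  show "eventually (\<lambda>x. eval_fps A (gen_arg \<beta> z x) * gen_denom x = - gen_num x) (nhds 0)"
  proof eventually_elim
    case (elim x)
    have nz: "x + 1 \<noteq> 0" "x * z + 1 \<noteq> 0"
      using elim gen_slit_nonzero by auto
    define P where "P = (x * z + 1) powr (- \<beta>)"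
    have P: "P \<noteq> 0" using nz by (simp add: P_def)
    have \<phi>x: "inverse (\<phi> x) = P / (x + 1)"
      by (simp add: \<phi>_def P_def powr_minus field_simps add_ac)
    have "eval_fps A (gen_arg \<beta> z x) * (- gen_denom x / ((x + 1)\<^sup>2 * (x * z + 1)) * P)
        = H x * (P / (x + 1))"
      using elim(1) DERIV_imp_deriv[OF gen_arg_has_field_derivative[OF elim(2)]]
      by (simp add: \<phi>x P_def)
    moreover have "F * D = - (h * X * Y)"
      if "F * (- D / (X\<^sup>2 * Y) * P) = h * (P / X)" "X \<noteq> 0" "Y \<noteq> 0" for F D h X Y :: complex
    proof -
      have "P * (F * D) = P * (- (h * X * Y))"
        using that by (simp add: field_simps power2_eq_square minus_equation_iff[of "D * _"])
      then show ?thesis using P mult_left_cancel by blast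
    qed
    ultimately have "eval_fps A (gen_arg \<beta> z x) * gen_denom x = - (H x * (x + 1) * (x * z + 1))"
      using nz by blast
    \<comment> \<open>The two linear factors raise the exponents \<open>m + \<alpha>\<close> and
      \<open>\<beta> * m\<close> by one.\<close>
    also have "H x * (x + 1) * (x * z + 1) = gen_num x"
      using nz by (simp add: H_def gen_num_def powr_add add_ac mult_ac)
    finally show ?case .
  qed
qed

section \<open>Analytic continuation to the whole domain\<close>

context
  assumes nonpole: "m + \<alpha> + 1 \<notin> \<int>\<^sub>\<le>\<^sub>0"
begin

text \<open>Written as a preimage of a disc of possibly infinite radius, the convergence condition
  is visibly open.\<close>

lemma gen_domain_eq:
  "gen_domain \<alpha> \<beta> m z = connected_component_set
     (gen_slit \<inter> gen_arg \<beta> z -` eball 0 (fps_conv_radius (Abs_fps (gen_coeff \<alpha> \<beta> m z)))) 0"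
  unfolding gen_domain_def gen_slit_def
  by (rule arg_cong2[where f = connected_component_set]) (auto simp: in_eball_iff fps_conv_radius_def)

lemma gen_domain_subset:
  "gen_domain \<alpha> \<beta> m z \<subseteq>
     gen_slit \<inter> gen_arg \<beta> z -` eball 0 (fps_conv_radius (Abs_fps (gen_coeff \<alpha> \<beta> m z)))"
  unfolding gen_domain_eq by (rule connected_component_subset)

lemma open_gen_domain: "open (gen_domain \<alpha> \<beta> m z)"
  unfolding gen_domain_eq
  by (intro open_connected_component continuous_open_preimage open_gen_slit open_eball
      holomorphic_on_imp_continuous_on gen_arg_holomorphic)

lemma connected_gen_domain: "connected (gen_domain \<alpha> \<beta> m z)"
  unfolding gen_domain_eq by (rule connected_connected_component)

lemma zero_in_gen_domain: "0 \<in> gen_domain \<alpha> \<beta> m z"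
  using gen_series_near_0(1)[OF nonpole]
  by (simp add: gen_domain_eq connected_component_refl_eq zero_in_gen_slit gen_arg_def
      in_eball_iff zero_ereal_def)

text \<open>Identity theorem: both sides are holomorphic on the open connected domain and agree on a
  neighbourhood of 0.\<close>

lemma gen_series_eq:
  assumes "x \<in> gen_domain \<alpha> \<beta> m z"
  shows "eval_fps (Abs_fps (gen_coeff \<alpha> \<beta> m z)) (gen_arg \<beta> z x) * gen_denom x = - gen_num x"
proof -
  define A where "A = Abs_fps (gen_coeff \<alpha> \<beta> m z)"
  obtain U where U: "open U" "0 \<in> U"
      "\<And>x. x \<in> U \<Longrightarrow> eval_fps A (gen_arg \<beta> z x) * gen_denom x = - gen_num x"
    using gen_series_near_0(2)[OF nonpole] unfolding eventually_nhds A_def by auto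
  have "(eval_fps A \<circ> gen_arg \<beta> z) holomorphic_on gen_domain \<alpha> \<beta> m z"
    by (rule holomorphic_on_compose_gen[where t = "eball 0 (fps_conv_radius A)"])
       (use gen_domain_subset in \<open>auto simp: A_def intro!: holomorphic_intros
          intro: holomorphic_on_subset[OF gen_arg_holomorphic]\<close>)
  then have hol: "(\<lambda>x. eval_fps A (gen_arg \<beta> z x) * gen_denom x) holomorphic_on gen_domain \<alpha> \<beta> m z"
    by (auto simp: o_def intro!: holomorphic_intros gen_denom_holomorphic)
  have hol': "(\<lambda>x. - gen_num x) holomorphic_on gen_domain \<alpha> \<beta> m z"
    using gen_domain_subset
    by (intro holomorphic_intros holomorphic_on_subset[OF gen_num_holomorphic]) auto
  show ?thesis
    unfolding A_def[symmetric]
    by (rule analytic_continuation_open[of "U \<inter> gen_domain \<alpha> \<beta> m z" "gen_domain \<alpha> \<beta> m z",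
          OF _ _ _ _ _ hol hol'])
       (use U open_gen_domain connected_gen_domain zero_in_gen_domain assms in auto)
qed

text \<open>A zero of \<open>gen_denom\<close> would make the left side of
  \<open>gen_series_eq\<close> vanish, whereas \<open>gen_num\<close> is a product of powers of
  nonzero numbers.\<close>

lemma gen_denom_nonzero:
  assumes "x \<in> gen_domain \<alpha> \<beta> m z"
  shows "gen_denom x \<noteq> 0"
proof -
  have "gen_num x \<noteq> 0"
    using assms gen_domain_subset gen_slit_nonzero[of x] by (auto simp: gen_num_def)
  then show ?thesis
    using gen_series_eq[OF assms] by auto
qed

lemma gen_coeff_sums:
  assumes "x \<in> gen_domain \<alpha> \<beta> m z"
  shows "(\<lambda>n. gen_coeff \<alpha> \<beta> m z n * gen_arg \<beta> z x ^ n) sums (- (gen_num x / gen_denom x))"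
proof -
  let ?A = "Abs_fps (gen_coeff \<alpha> \<beta> m z)"
  have "norm (gen_arg \<beta> z x) < fps_conv_radius ?A"
    using assms gen_domain_subset by (auto simp: in_eball_iff)
  then have "(\<lambda>n. gen_coeff \<alpha> \<beta> m z n * gen_arg \<beta> z x ^ n) sums eval_fps ?A (gen_arg \<beta> z x)"
    using sums_eval_fps[of "gen_arg \<beta> z x" ?A] by simp
  also have "eval_fps ?A (gen_arg \<beta> z x) = - (gen_num x / gen_denom x)"
    using gen_series_eq[OF assms] gen_denom_nonzero[OF assms] by (simp add: field_simps)
  finally show ?thesis .
qed

end

end

section \<open>Branches of the powers and the final statement\<close>

text \<open>Used for integer \<open>m\<close>, where the choice of logarithm does not affect the
  power.\<close>

lemma exp_int_mult_cong:
  fixes k a b :: complex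
  assumes "k \<in> \<int>" "exp a = exp b"
  shows "exp (k * a) = exp (k * b)"
  using assms by (elim Ints_cases) (simp add: exp_power_int[symmetric])

theorem proposition3p21:
  fixes \<alpha> \<beta> m z :: complex
  assumes "m + \<alpha> + 1 \<notin> \<int>\<^sub>\<le>\<^sub>0"
  shows "(\<exists>r>0. ball 0 r \<subseteq> gen_domain \<alpha> \<beta> m z) \<and>
    (\<forall>x \<in> gen_domain \<alpha> \<beta> m z - {0}.
       \<beta> * x\<^sup>2 * z + \<beta> * x * z - x * z - 1 \<noteq> 0 \<and>
       (m \<in> \<int> \<or> Ln (x * (x * z + 1) powr (- \<beta>) / (x + 1))
                   = Ln x - \<beta> * Ln (x * z + 1) - Ln (x + 1) \<longrightarrow>
         (\<lambda>n. Gamma (m + of_nat n + \<alpha> + 1)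
                * (x * (x * z + 1) powr (- \<beta>) / (x + 1)) ^ n
                * hyp2F1 (- of_nat n) (- ((m + of_nat n) * \<beta>)) (m + \<alpha> + 1) z
                / (Gamma (of_nat n + 1) * Gamma (m + \<alpha> + 1)))
         sums
           (- (x powr m * (x + 1) powr (\<alpha> + 1) * (x * z + 1)
                * (x * (x * z + 1) powr (- \<beta>) / (x + 1)) powr (- m)
               / (\<beta> * x\<^sup>2 * z + \<beta> * x * z - x * z - 1)))) \<and>
       (\<forall>l. exp l = x \<longrightarrow>
         (\<lambda>n. Gamma (m + of_nat n + \<alpha> + 1)
                * (x * (x * z + 1) powr (- \<beta>) / (x + 1)) ^ n
                * hyp2F1 (- of_nat n) (- ((m + of_nat n) * \<beta>)) (m + \<alpha> + 1) z
                / (Gamma (of_nat n + 1) * Gamma (m + \<alpha> + 1)))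
         sums
           (- (exp (m * l) * (x + 1) powr (\<alpha> + 1) * (x * z + 1)
                * exp (- m * (l - \<beta> * Ln (x * z + 1) - Ln (x + 1)))
               / (\<beta> * x\<^sup>2 * z + \<beta> * x * z - x * z - 1)))))"
proof (intro conjI ballI allI impI)
  show "\<exists>r>0. ball 0 r \<subseteq> gen_domain \<alpha> \<beta> m z"
    using open_gen_domain[OF assms] zero_in_gen_domain[OF assms] by (auto simp: open_contains_ball)
next
  fix x assume x: "x \<in> gen_domain \<alpha> \<beta> m z - {0}"
  let ?t = "x * (x * z + 1) powr (- \<beta>) / (x + 1)"
  let ?term = "\<lambda>n. Gamma (m + of_nat n + \<alpha> + 1) * ?t ^ n
                * hyp2F1 (- of_nat n) (- ((m + of_nat n) * \<beta>)) (m + \<alpha> + 1) z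
                / (Gamma (of_nat n + 1) * Gamma (m + \<alpha> + 1))"
  let ?D = "\<beta> * x\<^sup>2 * z + \<beta> * x * z - x * z - 1"
  show "?D \<noteq> 0"
    using gen_denom_nonzero[OF assms] x by (simp add: gen_denom_def)
  have nz: "x \<noteq> 0" "x + 1 \<noteq> 0" "x * z + 1 \<noteq> 0"
    using x gen_domain_subset[OF assms, of \<beta> z] gen_slit_nonzero[of x z] by auto
  \<comment> \<open>The branch-free value of \<open>x^m\<close> times the power \<open>- m\<close>
    of the series argument; both forms of the result reduce to it.\<close>
  let ?E = "exp (m * (\<beta> * Ln (x * z + 1) + Ln (x + 1)))"
  have num: "gen_num \<alpha> \<beta> m z x = ?E * (x + 1) powr (\<alpha> + 1) * (x * z + 1)"
    using nz by (simp add: gen_num_def powr_add) (simp add: powr_def exp_add algebra_simps)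
  have "?term = (\<lambda>n. gen_coeff \<alpha> \<beta> m z n * gen_arg \<beta> z x ^ n)"
    by (simp add: fun_eq_iff gen_coeff_def gen_arg_def mult_ac)
  then have sums: "?term sums (- (?E * (x + 1) powr (\<alpha> + 1) * (x * z + 1) / ?D))"
    using gen_coeff_sums[OF assms, where x = x and \<beta> = \<beta> and z = z] x
    unfolding num[symmetric] by (simp add: gen_denom_def)
  have reorder: "a * b * c * d = a * d * b * c" for a b c d :: complex
    by (simp only: mult_ac)
  show "?term sums (- (exp (m * l) * (x + 1) powr (\<alpha> + 1) * (x * z + 1)
                * exp (- m * (l - \<beta> * Ln (x * z + 1) - Ln (x + 1))) / ?D))" for l
  proof -
    \<comment> \<open>The chosen logarithm \<open>l\<close> of \<open>x\<close> cancels in the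
      exponent.\<close>
    have "exp (m * l) * exp (- m * (l - \<beta> * Ln (x * z + 1) - Ln (x + 1))) = ?E"
      by (simp add: exp_add[symmetric] algebra_simps)
    with sums show ?thesis by (subst reorder) (simp only:)
  qed
  assume m: "m \<in> \<int> \<or> Ln ?t = Ln x - \<beta> * Ln (x * z + 1) - Ln (x + 1)"
  have t: "?t \<noteq> 0" using nz by simp
  \<comment> \<open>Both exponents are logarithms of \<open>?t\<close>, but may differ by a multiple
    of \<open>2 * pi * \<i>\<close>. After multiplication by \<open>- m\<close> this is harmless if
    \<open>m\<close> is an integer; otherwise \<open>m\<close> supplies their equality.\<close>
  have "exp (Ln ?t) = exp (Ln x - \<beta> * Ln (x * z + 1) - Ln (x + 1))"
    using nz t by (simp add: exp_diff powr_def exp_minus divide_inverse mult_ac)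
  then have "exp (- m * Ln ?t) = exp (- m * (Ln x - \<beta> * Ln (x * z + 1) - Ln (x + 1)))"
    using m exp_int_mult_cong[of "- m"] by auto
  then have "x powr m * ?t powr (- m)
      = exp (m * Ln x) * exp (- m * (Ln x - \<beta> * Ln (x * z + 1) - Ln (x + 1)))"
    using nz t by (simp add: powr_def)
  also have "\<dots> = ?E"
    by (simp add: exp_add[symmetric] algebra_simps)
  finally have "x powr m * ?t powr (- m) = ?E" .
  with sums show "?term sums (- (x powr m * (x + 1) powr (\<alpha> + 1) * (x * z + 1) * ?t powr (- m) / ?D))"
    by (subst reorder) (simp only:)
qed

end
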